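(* Let $k\ge 2$, $n\ge 3$ and $k,n\in\mathbb{N}$. The cycle $C_n$ is $k$-distance magic if and only if $n=4k$.
   Context: All graphs are finite, simple and undirected; $d(u,v)$ is graph distance. For $u\in V(G)$ and $k\in\mathbb{N}$, $\partial N_k(u)=\{v\in V(G): d(u,v)=k\}$. For a graph $G$ of order $n\ge3$, a $k$-distance magic labeling ($k$-DML) is a bijection $f:V(G)\to\{1,\dots,n\}$ together with a constant $M$ such that $\sum_{w\in\partial N_k(u)} f(w)=M$ for every vertex $u$ with $\partial N_k(u)\neq\emptyset$; moreover $G$ is required to contain at least one pair of vertices at distance $k$. $G$ is $k$-distance magic ($k$-DM) if it has a $k$-DML. *)

theory Defs
  imports "Graph_Theory.Graph_Theory"
begin

context graph
begin

text \<open>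
  Finite simple undirected graphs are the symmetric, loop-free digraphs without parallel arcs of
  the locale \<^locale>\<open>graph\<close>. The graph distance is the least length of a walk, that is, the
  library's shortest-path cost for unit arc weights; it is infinite if there is no walk.
\<close>

definition gdist :: "'a \<Rightarrow> 'a \<Rightarrow> ereal" where
  "gdist u v = \<mu> (\<lambda>_. 1) u v"

definition sphere_nbhd :: "nat \<Rightarrow> 'a \<Rightarrow> 'a set" where
  "sphere_nbhd k u = {v \<in> verts G. gdist u v = ereal (real k)}"

definition distance_magic_labeling :: "nat \<Rightarrow> ('a \<Rightarrow> nat) \<Rightarrow> nat \<Rightarrow> bool" where
  "distance_magic_labeling k f M \<longleftrightarrow>
     3 \<le> card (verts G) \<and>
     bij_betw f (verts G) {1..card (verts G)} \<and>
     (\<exists>u\<in>verts G. \<exists>v\<in>verts G. gdist u v = ereal (real k)) \<and>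
     (\<forall>u\<in>verts G. sphere_nbhd k u \<noteq> {} \<longrightarrow> (\<Sum>w\<in>sphere_nbhd k u. f w) = M)"

definition distance_magic :: "nat \<Rightarrow> bool" where
  "distance_magic k \<longleftrightarrow> (\<exists>f M. distance_magic_labeling k f M)"

end

text \<open>
  The cycle on the vertices \<open>0, \<dots>, n - 1\<close>; every undirected edge is represented by its two
  orientations. This is the usual cycle for \<open>n \<ge> 3\<close> only.
\<close>

definition cycle_graph :: "nat \<Rightarrow> nat pair_pre_digraph" where
  "cycle_graph n =
     \<lparr> pverts = {0..<n},
       parcs = {(i, j). i < n \<and> j < n \<and> (j = (i + 1) mod n \<or> i = (j + 1) mod n)} \<rparr>"

text \<open>
  The locale definitions above unfold only for a graph satisfying the locale assumptions, so they
  are meaningful for the cycle by virtue of the following fact.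
\<close>

lemma graph_cycle_graph:
  assumes "3 \<le> n"
  shows "graph (with_proj (cycle_graph n))"
proof -
  have sub: "parcs (cycle_graph n) \<subseteq> {0..<n} \<times> {0..<n}"
    by (auto simp: cycle_graph_def)
  have fin: "finite (parcs (cycle_graph n))"
    by (rule finite_subset[OF sub]) simp
  have ne: "i \<noteq> (i + 1) mod n" if "i < n" for i
    using that assms by (cases "i + 1 = n") auto
  interpret pair_graph "cycle_graph n"
  proof unfold_locales
    show "finite (parcs (cycle_graph n))" by (rule fin)
    show "fst e \<noteq> snd e" if "e \<in> parcs (cycle_graph n)" for e
      using that ne by (fastforce simp: cycle_graph_def)
    show "symmetric (with_proj (cycle_graph n))"
      by (auto simp: symmetric_def cycle_graph_def intro!: symI)
  qed (auto simp: cycle_graph_def)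
  show ?thesis by unfold_locales
qed

end

theory Submission
  imports Defs
begin

text \<open>
  On \<open>C\<^sub>n\<close> the distance of two vertices is \<open>min d (n - d)\<close>, where \<open>d\<close> is the difference of their
  indices. So if \<open>2k > n\<close> no two vertices are at distance \<open>k\<close>, if \<open>2k = n\<close> every sphere of radius
  \<open>k\<close> is a singleton and a labeling would be constant, and if \<open>2k < n\<close> the sphere about \<open>u\<close> is
  \<open>{u - k, u + k}\<close>. In the last case, comparing the spheres about \<open>k\<close> and \<open>3k\<close> gives
  \<open>f 0 = f (4k)\<close> with indices modulo \<open>n\<close>, so \<open>n\<close> divides \<open>4k < 2n\<close> and \<open>n = 4k\<close>. Conversely, for \<open>n = 4k\<close> every sphere
  is a pair \<open>{x, x + 2k}\<close>, and the labels \<open>1, \<dots>, n\<close> can be distributed so that opposite ones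
  sum to \<open>n + 1\<close>.
\<close>

definition cycle_dist :: "nat \<Rightarrow> nat \<Rightarrow> nat \<Rightarrow> nat" where
  "cycle_dist n u v = (let d = max u v - min u v in min d (n - d))"

lemma pverts_cycle_graph [simp]: "pverts (cycle_graph n) = {0..<n}"
  by (simp add: cycle_graph_def)

text \<open>Eliminates \<open>mod\<close>, so that the case analyses below are linear
  arithmetic.\<close>

lemma arcs_cycle_graph_iff:
  assumes "3 \<le> n"
  shows "(i, j) \<in> arcs (with_proj (cycle_graph n)) \<longleftrightarrow> i < n \<and> j < n \<and>
    (j = i + 1 \<or> i = j + 1 \<or> i = 0 \<and> j + 1 = n \<or> j = 0 \<and> i + 1 = n)"
proof -
  have "j = (i + 1) mod n \<longleftrightarrow> j = i + 1 \<or> j = 0 \<and> i + 1 = n" if "i < n" "j < n" for i j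
    using that assms by (cases "i + 1 = n") auto
  from this[of i j] this[of j i] show ?thesis
    by (auto simp: cycle_graph_def)
qed

text \<open>The lower bound for the graph distance: by induction along a walk, no walk from u to v
  can be shorter than \<open>cycle_dist n u v\<close>.\<close>

lemma cycle_dist_arc_le:
  assumes "3 \<le> n" and "(u, w) \<in> arcs (with_proj (cycle_graph n))" and "v < n"
  shows "cycle_dist n u v \<le> Suc (cycle_dist n w v)"
  using assms unfolding arcs_cycle_graph_iff[OF assms(1)] cycle_dist_def Let_def
  by (auto simp: max_def min_def)

lemma cycle_dist_eq_0_iff:
  assumes "u < n" and "v < n"
  shows "cycle_dist n u v = 0 \<longleftrightarrow> u = v"
  using assms by (auto simp: cycle_dist_def Let_def min_def max_def)

text \<open>The upper bound for the graph distance: iterating this step builds a walk of length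
  exactly \<open>cycle_dist n u v\<close>.\<close>

lemma cycle_dist_step:
  assumes "3 \<le> n" and "u < n" and "v < n" and "cycle_dist n u v = Suc m"
  obtains w where "(u, w) \<in> arcs (with_proj (cycle_graph n))" and "cycle_dist n w v = m"
proof -
  \<comment> \<open>The neighbour of u on a shorter way round to v: go up if v lies above and the
    direct way is at most half the cycle, or if v lies below and the way through n - 1 and 0 is
    shorter; otherwise go down.\<close>
  define w where "w =
    (if (u < v \<longleftrightarrow> 2 * (max u v - min u v) \<le> n) then (if u + 1 = n then 0 else u + 1)
     else (if u = 0 then n - 1 else u - 1))"
  have "(u, w) \<in> arcs (with_proj (cycle_graph n))"
    using assms unfolding arcs_cycle_graph_iff[OF assms(1)] w_def by auto
  moreover have "cycle_dist n w v = m"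
    using assms unfolding w_def cycle_dist_def Let_def
    by (auto simp: max_def min_def split: if_splits)
  ultimately show ?thesis by (rule that)
qed

lemma cycle_dist_le_length:
  assumes n: "3 \<le> n" and "v < n"
    and "pre_digraph.awalk (with_proj (cycle_graph n)) u p v"
  shows "cycle_dist n u v \<le> length p"
proof -
  interpret graph "with_proj (cycle_graph n)" by (rule graph_cycle_graph[OF n])
  show ?thesis using assms(3)
  proof (induction p arbitrary: u)
    case Nil
    then show ?case by (auto simp: awalk_Nil_iff cycle_dist_def)
  next
    case (Cons e p)
    obtain a w where e: "e = (a, w)" by (cases e)
    from Cons.prems have "(u, w) \<in> arcs (with_proj (cycle_graph n))" and "awalk w p v"
      unfolding awalk_Cons_iff e by auto
    with Cons.IH[of w] cycle_dist_arc_le[OF n _ \<open>v < n\<close>, of u w] show ?case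
      by simp
  qed
qed

lemma ex_awalk_length_eq_cycle_dist:
  assumes n: "3 \<le> n" and "u < n" and "v < n"
  shows "\<exists>p. pre_digraph.awalk (with_proj (cycle_graph n)) u p v \<and> length p = cycle_dist n u v"
proof -
  interpret graph "with_proj (cycle_graph n)" by (rule graph_cycle_graph[OF n])
  show ?thesis using \<open>u < n\<close>
  proof (induction "cycle_dist n u v" arbitrary: u)
    case 0
    then have "awalk u [] v"
      using \<open>v < n\<close> cycle_dist_eq_0_iff[of u n v] by (auto simp: awalk_Nil_iff)
    with 0 show ?case by force
  next
    case (Suc m)
    obtain w where w: "(u, w) \<in> arcs (with_proj (cycle_graph n))" "cycle_dist n w v = m"
      using cycle_dist_step[OF n Suc.prems \<open>v < n\<close>] Suc.hyps(2) by metis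
    then have "w < n" by (simp add: arcs_cycle_graph_iff[OF n] del: with_proj_simps)
    with Suc.hyps(1)[of w] w obtain p where p: "awalk w p v" "length p = m" by auto
    have "awalk u ((u, w) # p) v" using p w(1) Suc.prems by (simp add: awalk_Cons_iff)
    with p(2) Suc.hyps(2) show ?case by (metis length_Cons)
  qed
qed

lemma gdist_cycle_graph:
  assumes n: "3 \<le> n" and "u < n" and "v < n"
  shows "graph.gdist (with_proj (cycle_graph n)) u v = ereal (real (cycle_dist n u v))"
proof -
  interpret graph "with_proj (cycle_graph n)" by (rule graph_cycle_graph[OF n])
  have cost: "awalk_cost (\<lambda>_. 1) p = real (length p)" for p
    by (induction p) auto
  show ?thesis
  proof (rule antisym)
    obtain p where "awalk u p v" "length p = cycle_dist n u v"
      using ex_awalk_length_eq_cycle_dist[OF assms] by blast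
    then show "gdist u v \<le> ereal (real (cycle_dist n u v))"
      unfolding gdist_def \<mu>_def by (intro INF_lower2[of p]) (auto simp: cost)
    show "ereal (real (cycle_dist n u v)) \<le> gdist u v"
      unfolding gdist_def \<mu>_def
      using cycle_dist_le_length[OF n \<open>v < n\<close>, of u] by (intro INF_greatest) (auto simp: cost)
  qed
qed

lemma sphere_nbhd_cycle_graph:
  assumes "3 \<le> n" and "u < n"
  shows "graph.sphere_nbhd (with_proj (cycle_graph n)) k u = {v. v < n \<and> cycle_dist n u v = k}"
proof -
  interpret graph "with_proj (cycle_graph n)" by (rule graph_cycle_graph[OF assms(1)])
  show ?thesis
    using gdist_cycle_graph[OF assms] by (auto simp: sphere_nbhd_def)
qed

text \<open>The entries are u + k and u - k modulo n; they coincide exactly when 2k = n.\<close>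

lemma sphere_nbhd_cycle_graph_pair:
  assumes "3 \<le> n" and "u < n" and "0 < k" and "2 * k \<le> n"
  shows "graph.sphere_nbhd (with_proj (cycle_graph n)) k u =
    {(if u + k < n then u + k else u + k - n), (if k \<le> u then u - k else u + n - k)}"
  unfolding sphere_nbhd_cycle_graph[OF assms(1,2)] cycle_dist_def Let_def
  using assms by (auto simp: min_def max_def split: if_splits)

text \<open>Whether a sphere of radius k is nonempty does not depend on its centre, so the existence
  of a pair at distance k and the nonemptiness guard both reduce to 2k \<le> n.\<close>

lemma distance_magic_labeling_cycle_graph_iff:
  assumes "3 \<le> n"
  shows "graph.distance_magic_labeling (with_proj (cycle_graph n)) k f M \<longleftrightarrow>
    bij_betw f {0..<n} {1..n} \<and> 2 * k \<le> n \<and>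
    (\<forall>u<n. sum f (graph.sphere_nbhd (with_proj (cycle_graph n)) k u) = M)"
proof -
  interpret graph "with_proj (cycle_graph n)" by (rule graph_cycle_graph[OF assms])
  have ex: "(\<exists>v<n. cycle_dist n u v = k) \<longleftrightarrow> 2 * k \<le> n" if "u < n" for u
  proof
    assume "\<exists>v<n. cycle_dist n u v = k"
    with that show "2 * k \<le> n"
      by (auto simp: cycle_dist_def Let_def min_def max_def split: if_splits)
  next
    assume "2 * k \<le> n"
    with that assms show "\<exists>v<n. cycle_dist n u v = k"
      \<comment> \<open>If u + k \<ge> n, then u \<ge> n - k \<ge> k, so \<open>u - k\<close> is not
        truncated.\<close>
      by (intro exI[of _ "if u + k < n then u + k else u - k"])
        (auto simp: cycle_dist_def Let_def min_def max_def)
  qed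
  have ne: "sphere_nbhd k u \<noteq> {} \<longleftrightarrow> 2 * k \<le> n" if "u < n" for u
    using ex[OF that] by (auto simp: sphere_nbhd_cycle_graph[OF assms that])
  have "(\<exists>u\<in>{0..<n}. \<exists>v\<in>{0..<n}. gdist u v = ereal (real k)) \<longleftrightarrow> 2 * k \<le> n"
  proof -
    have "(\<exists>v\<in>{0..<n}. gdist u v = ereal (real k)) \<longleftrightarrow> 2 * k \<le> n" if "u < n" for u
      using ex[OF that] gdist_cycle_graph[OF assms that] by auto
    then show ?thesis using assms by force
  qed
  then show ?thesis
    using assms ne unfolding distance_magic_labeling_def by auto
qed

lemma cycle_distance_magic_imp:
  assumes "3 \<le> n" and "0 < k"
    and "graph.distance_magic_labeling (with_proj (cycle_graph n)) k f M"
  shows "n = 4 * k"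
proof -
  note sphere = sphere_nbhd_cycle_graph_pair[OF \<open>3 \<le> n\<close> _ \<open>0 < k\<close>]
  have bij: "bij_betw f {0..<n} {1..n}" and le: "2 * k \<le> n"
    and M: "\<And>u. u < n \<Longrightarrow> sum f (graph.sphere_nbhd (with_proj (cycle_graph n)) k u) = M"
    using assms(3) unfolding distance_magic_labeling_cycle_graph_iff[OF assms(1)] by auto
  have inj: "x = y" if "f x = f y" "x < n" "y < n" for x y
    using bij_betw_imp_inj_on[OF bij] that by (auto dest: inj_onD)
  \<comment> \<open>The spheres about 0 and 1 would be {k} and {k + 1}; n \<ge> 3 gives k \<ge> 2,
    so k + 1 is still a vertex index.\<close>
  have "2 * k \<noteq> n"
  proof
    assume "2 * k = n"
    then have "f k = M" and "f (k + 1) = M"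
      using M[of 0] M[of 1] sphere[of 0] sphere[of 1] assms by (auto simp: add.commute)
    with inj[of k "k + 1"] \<open>2 * k = n\<close> assms show False by simp
  qed
  with le have lt: "2 * k < n" by simp
  have k: "f (2 * k) + f 0 = M"
    using M[of k] sphere[of k] lt \<open>0 < k\<close> by (simp add: mult_2)
  \<comment> \<open>3k and 4k modulo n; one subtraction suffices because 4k < 2n. As n \<noteq> 2k,
    w differs from 2k, so the sphere about u has two distinct elements.\<close>
  define u where "u = (if 3 * k < n then 3 * k else 3 * k - n)"
  define w where "w = (if 4 * k < n then 4 * k else 4 * k - n)"
  have "u < n" "w < n" "w \<noteq> 2 * k" using lt \<open>0 < k\<close> by (auto simp: u_def w_def)
  have "graph.sphere_nbhd (with_proj (cycle_graph n)) k u = {w, 2 * k}"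
    unfolding sphere[OF \<open>u < n\<close> le] using lt \<open>0 < k\<close>
    by (auto simp: u_def w_def)
  with M[OF \<open>u < n\<close>] \<open>w \<noteq> 2 * k\<close> have "f w + f (2 * k) = M" by simp
  with k have "f w = f 0" by simp
  with inj[of w 0] \<open>w < n\<close> have "w = 0" by simp
  with lt \<open>0 < k\<close> show ?thesis by (auto simp: w_def split: if_splits)
qed

text \<open>Labels 1, ..., 2k ascend on the first half and 4k, ..., 2k + 1 descend on the second, so
  i and i + 2k receive (i + 1) + (4k - i) = 4k + 1.\<close>

definition antipodal_labeling :: "nat \<Rightarrow> nat \<Rightarrow> nat" where
  "antipodal_labeling k i = (if i < 2 * k then i + 1 else 6 * k - i)"

lemma distance_magic_labeling_antipodal:
  assumes "0 < k"
  shows "graph.distance_magic_labeling (with_proj (cycle_graph (4 * k))) k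
    (antipodal_labeling k) (4 * k + 1)"
proof -
  have n: "3 \<le> 4 * k" using assms by simp
  have "bij_betw (antipodal_labeling k) {0..<4 * k} {1..4 * k}"
    \<comment> \<open>Reflection in 6k undoes itself; the cut moves from i < 2k to j \<le> 2k
      because labels start at 1.\<close>
    by (rule bij_betw_byWitness[where f' = "\<lambda>j. if j \<le> 2 * k then j - 1 else 6 * k - j"])
      (auto simp: antipodal_labeling_def)
  moreover have "sum (antipodal_labeling k)
      (graph.sphere_nbhd (with_proj (cycle_graph (4 * k))) k u) = 4 * k + 1" if "u < 4 * k" for u
    unfolding sphere_nbhd_cycle_graph_pair[OF n that assms, simplified]
    using that assms by (auto simp: antipodal_labeling_def)
  ultimately show ?thesis
    unfolding distance_magic_labeling_cycle_graph_iff[OF n] by simp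
qed

theorem theorem2p6:
  fixes k n :: nat
  assumes "k \<ge> 2" and "n \<ge> 3"
  shows "graph.distance_magic (with_proj (cycle_graph n)) k \<longleftrightarrow> n = 4 * k"
proof -
  interpret graph "with_proj (cycle_graph n)" by (rule graph_cycle_graph[OF assms(2)])
  show ?thesis
    unfolding distance_magic_def
    using assms cycle_distance_magic_imp[of n k] distance_magic_labeling_antipodal[of k] by auto
qed

end
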